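(* Let $\mathcal{P}_i$ be a path with links $\mathcal{P}_{i,1},\ldots,\mathcal{P}_{i,|\mathcal{P}_i|}$, each of which is either data-corrupting or packet-dropping, with link failure indicator processes $\{l_{\mathcal{P}_i}^{\mathcal{P}_{i,j}}(t)\in\{0,1\}\}_{t\in\mathbb{N}_0}$, $j\in\{1,\ldots,|\mathcal{P}_i|\}$ (not assumed to be mutually independent), and let $\{l_{\mathcal{P}_i}(t)\in\{0,1\}\}_{t\in\mathbb{N}_0}$ be the failure indicator process of the path. Assume $l_{\mathcal{P}_i}^{\mathcal{P}_{i,j}}\in\Lambda_{\rho_{\mathcal{P}_i}^{\mathcal{P}_{i,j}}}$ with $\rho_{\mathcal{P}_i}^{\mathcal{P}_{i,j}}\in[0,1]$, $j\in\{1,\ldots,|\mathcal{P}_i|\}$, that satisfy $\sum_{j=1}^{|\mathcal{P}_i|}\rho_{\mathcal{P}_i}^{\mathcal{P}_{i,j}}\le1$. Then $l_{\mathcal{P}_i}\in\Lambda_{\rho_{\mathcal{P}_i}}$ with $\rho_{\mathcal{P}_i}\triangleq\sum_{j=1}^{|\mathcal{P}_i|}\rho_{\mathcal{P}_i}^{\mathcal{P}_{i,j}}$.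
   Context: All processes are defined on a common probability space $(\Omega,\mathcal{F},\mathbb{P})$. $\vee$ denotes the or-operation on binary numbers. Class $\Lambda_\rho$: for $\rho\in[0,1]$, $\Lambda_\rho$ is the class of binary-valued processes $l=\{l(t)\in\{0,1\}\}_{t\in\mathbb{N}_0}$ such that $\sum_{k=1}^{\infty}\mathbb{P}[\sum_{t=0}^{k-1}l(t)>\rho k]<\infty$. Links and indexing: a path is a sequence of links $\mathcal{P}=((v_1,v_2),(v_2,v_3),\ldots,(v_h,v_{h+1}))$, $h\ge1$. Each link is either data-corrupting (every packet available at its tail node reaches its head node, but possibly corrupted) or packet-dropping (packets may be dropped, but are never corrupted). The link indicator for $(v_j,v_{j+1})$ at index $t$ equals $1$ if the $(t+1)$th packet that node $v_j$ possesses (i.e. receives along the path) fails on that link, and $0$ otherwise. Path failure indicator $l_{\mathcal{P}}$ (recursive definition): $l_{\mathcal{P}}(t)=0$ indicates that the $(t+1)$th packet possessed by $v_1$ is successfully transmitted to $v_{h+1}$, and $l_{\mathcal{P}}(t)=1$ indicates a failure. If $h=1$, $l_{\mathcal{P}}$ is the indicator process of the single link. If $h\ge2$, let $f(\mathcal{P})=(v_1,v_2)$ be the first link, with link indicator process $l_{\mathcal{P}}^{f(\mathcal{P})}$, and let $\mathcal{R}(\mathcal{P})=((v_2,v_3),\ldots,(v_h,v_{h+1}))$ be the remaining subpath, with path failure indicator process $l_{\mathcal{P}}^{\mathcal{R}(\mathcal{P})}$ (defined by the same recursion from the indicators of its links). Then $$l_{\mathcal{P}}(t)=l_{\mathcal{P}}^{f(\mathcal{P})}(t)\vee\widehat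 l_{\mathcal{P}}^{\mathcal{R}(\mathcal{P})}(t),\quad t\in\mathbb{N}_0,$$ where: if $f(\mathcal{P})$ is data-corrupting, $\widehat l_{\mathcal{P}}^{\mathcal{R}(\mathcal{P})}(t)=l_{\mathcal{P}}^{\mathcal{R}(\mathcal{P})}(t)$; if $f(\mathcal{P})$ is packet-dropping, $\widehat l_{\mathcal{P}}^{\mathcal{R}(\mathcal{P})}(t)=0$ when $l_{\mathcal{P}}^{f(\mathcal{P})}(t)=1$, and $\widehat l_{\mathcal{P}}^{\mathcal{R}(\mathcal{P})}(t)=l_{\mathcal{P}}^{\mathcal{R}(\mathcal{P})}(\hat k(t+1)-1)$ when $l_{\mathcal{P}}^{f(\mathcal{P})}(t)=0$, with $\hat k(t)\triangleq\sum_{i=0}^{t-1}(1-l_{\mathcal{P}}^{f(\mathcal{P})}(i))$, $t\in\mathbb{N}$. For $\mathcal{P}=\mathcal{P}_i$, the $j$th link is denoted $\mathcal{P}_{i,j}$, its indicator process $l_{\mathcal{P}_i}^{\mathcal{P}_{i,j}}$, and the number of links $|\mathcal{P}_i|$. *)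

theory Defs
  imports "HOL-Probability.Probability"
begin

unbundle bit_operations_syntax

text \<open>A process takes values in \<open>nat\<close>; that it is binary-valued is part of membership
  in the class below, as measurability into \<open>count_space {0, 1}\<close>.\<close>

type_synonym 'a process = "nat \<Rightarrow> 'a \<Rightarrow> nat"

definition binary_process :: "'a measure \<Rightarrow> 'a process \<Rightarrow> bool" where
  "binary_process M l \<longleftrightarrow> (\<forall>t. l t \<in> measurable M (count_space {0, 1}))"

definition Lambda_class :: "'a measure \<Rightarrow> real \<Rightarrow> 'a process set" where
  "Lambda_class M \<rho> = {l. binary_process M l \<and>
     (\<lambda>k. measure M {\<omega> \<in> space M. real (\<Sum>t = 0..<k. l t \<omega>) > \<rho> * real k}) summable_on {1..}}"

datatype link_kind = Data_Corrupting | Packet_Dropping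

record 'v link =
  link_tail :: 'v
  link_head :: 'v
  link_kind :: link_kind

definition is_path :: "'v link list \<Rightarrow> bool" where
  "is_path P \<longleftrightarrow> P \<noteq> [] \<and> successively (\<lambda>e e'. link_head e = link_tail e') P"

text \<open>The number of packets, among the first \<open>k\<close> ones, that get through a packet-dropping
  link with indicator \<open>l\<close>. The subtraction is not truncated since \<open>l\<close> is binary.\<close>

definition received_count :: "'a process \<Rightarrow> nat \<Rightarrow> 'a \<Rightarrow> nat" where
  "received_count l k \<omega> = (\<Sum>i = 0..<k. 1 - l i \<omega>)"

text \<open>The failure indicator \<open>lR\<close> of the remaining subpath, re-indexed by the packets of the
  first node. If \<open>lf t \<omega> = 0\<close>, then \<open>received_count lf (t + 1) \<omega> \<ge> 1\<close>, so the
  subtraction is not truncated.\<close>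

fun reindexed :: "link_kind \<Rightarrow> 'a process \<Rightarrow> 'a process \<Rightarrow> 'a process" where
  "reindexed Data_Corrupting lf lR t \<omega> = lR t \<omega>"
| "reindexed Packet_Dropping lf lR t \<omega> =
     (if lf t \<omega> = 1 then 0 else lR (received_count lf (t + 1) \<omega> - 1) \<omega>)"

text \<open>Links are numbered from 1: \<open>l j\<close> is the indicator process of the \<open>j\<close>-th link, so
  that the \<open>j\<close>-th link of the remaining subpath has indicator \<open>l (j + 1)\<close>. The value on the
  empty list is unspecified, as a path has at least one link.\<close>

fun path_failure :: "'v link list \<Rightarrow> (nat \<Rightarrow> 'a process) \<Rightarrow> 'a process" where
  "path_failure [e] l = l 1"
| "path_failure (e # e' # R) l = (\<lambda>t \<omega>.
     l 1 t \<omega> OR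
     reindexed (link_kind e) (l 1) (path_failure (e' # R) (\<lambda>j. l (j + 1))) t \<omega>)"

end

theory Submission
  imports Defs
begin

text \<open>If the first link drops packets, then among the first \<open>k\<close> packets the path fails on exactly
  those that the first link drops and those of the \<open>received_count l k\<close> surviving ones that the
  remaining subpath fails on. Since at most \<open>k\<close> packets survive, in either case the number of
  failures is bounded by the sum of the two separate failure counts up to \<open>k\<close>, and a union bound
  gives the claim for two processes; induction along the path does the rest.\<close>

text \<open>Values and measurability are separated because sums, compositions and case distinctions
  on indicators are shown measurable into \<open>count_space UNIV\<close>, while lying in
  \<open>{0, 1}\<close> is checked pointwise on \<open>space M\<close>.\<close>

lemma binary_process_iff:
  "binary_process M l \<longleftrightarrow>
     (\<forall>t. l t \<in> measurable M (count_space UNIV) \<and> (\<forall>\<omega>\<in>space M. l t \<omega> \<in> {0, 1}))"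
proof -
  have "count_space {0, 1 :: nat} = restrict_space (count_space UNIV) {0, 1}"
    by (simp add: restrict_count_space)
  then show ?thesis
    unfolding binary_process_def by (simp only: measurable_restrict_space2_iff Pi_iff)
qed

lemma binary_or_nat:
  fixes a b :: nat
  assumes "a \<in> {0, 1}" "b \<in> {0, 1}"
  shows "a OR b \<in> {0, 1}" and "a OR b \<le> a + b"
  using assms by auto

lemma received_count_le: "received_count l k \<omega> \<le> k"
  unfolding received_count_def using sum_mono[of "{0..<k}" "\<lambda>i. 1 - l i \<omega>" "\<lambda>_. 1"] by simp

lemma sum_or_dropping:
  assumes "\<And>t. lf t \<omega> \<in> {0, 1}"
  shows "(\<Sum>t = 0..<k. lf t \<omega> OR reindexed Packet_Dropping lf lR t \<omega>) =
    (\<Sum>t = 0..<k. lf t \<omega>) + (\<Sum>s = 0..<received_count lf k \<omega>. lR s \<omega>)"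
proof (induction k)
  case 0
  then show ?case by (simp add: received_count_def)
next
  case (Suc k)
  have "lf k \<omega> = 0 \<or> lf k \<omega> = 1"
    using assms[of k] by auto
  \<comment> \<open>A dropped packet adds 1 to the first sum and leaves
    \<open>received_count\<close> unchanged. For a surviving packet \<open>k\<close>,
    \<open>received_count lf (k + 1) - 1\<close> equals \<open>received_count lf k\<close>, exactly
    the index of the term by which the last sum grows.\<close>
  then show ?case
    using Suc.IH by (elim disjE) (simp_all add: received_count_def)
qed

lemma sum_or_reindexed_le:
  assumes "\<And>t. lf t \<omega> \<in> {0, 1}" "\<And>t. lR t \<omega> \<in> {0, 1}"
  shows "(\<Sum>t = 0..<k. lf t \<omega> OR reindexed d lf lR t \<omega>) \<le>
    (\<Sum>t = 0..<k. lf t \<omega>) + (\<Sum>t = 0..<k. lR t \<omega>)"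
proof (cases d)
  case Data_Corrupting
  then show ?thesis
    using binary_or_nat(2)[OF assms] by (simp add: sum.distrib[symmetric] sum_mono)
next
  case Packet_Dropping
  have "(\<Sum>s = 0..<received_count lf k \<omega>. lR s \<omega>) \<le> (\<Sum>s = 0..<k. lR s \<omega>)"
    using received_count_le[of lf k \<omega>] by (intro sum_mono2) auto
  then show ?thesis
    unfolding Packet_Dropping by (subst sum_or_dropping) (rule assms(1), rule add_left_mono)
qed

lemma binary_process_or_reindexed:
  assumes "binary_process M lf" "binary_process M lR"
  shows "binary_process M (\<lambda>t \<omega>. lf t \<omega> OR reindexed d lf lR t \<omega>)"
proof -
  have [measurable]: "\<And>t. lf t \<in> measurable M (count_space UNIV)"
      "\<And>t. lR t \<in> measurable M (count_space UNIV)"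
    and bin: "\<And>t \<omega>. \<omega> \<in> space M \<Longrightarrow> lf t \<omega> \<in> {0, 1}" "\<And>t \<omega>. \<omega> \<in> space M \<Longrightarrow> lR t \<omega> \<in> {0, 1}"
    using assms unfolding binary_process_iff by auto
  have [measurable]: "(\<lambda>\<omega>. reindexed d lf lR t \<omega>) \<in> measurable M (count_space UNIV)" for t
  proof (cases d)
    case Packet_Dropping
    have [measurable]: "received_count lf k \<in> measurable M (count_space UNIV)" for k
      unfolding received_count_def by measurable
    \<comment> \<open>The index of \<open>lR\<close> is random but takes countably many values, so
      the composition is glued from the measurable functions \<open>lR n\<close> over the level sets
      of the index.\<close>
    have "(\<lambda>\<omega>. lR (received_count lf (t + 1) \<omega> - 1) \<omega>) \<in> measurable M (count_space UNIV)"
      by (rule measurable_compose_countable[where f = lR]) measurable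
    then show ?thesis
      unfolding Packet_Dropping reindexed.simps by measurable
  qed simp
  \<comment> \<open>With a constant left operand, OR is a map on a discrete space, so composing with
    it preserves measurability. The constant is then replaced by \<open>lf t\<close>, which again
    has countably many values.\<close>
  have "(\<lambda>\<omega>. a OR reindexed d lf lR t \<omega>) \<in> measurable M (count_space UNIV)" for a t
    by (rule measurable_compose[of _ _ "count_space UNIV"]) simp_all
  then have "(\<lambda>\<omega>. lf t \<omega> OR reindexed d lf lR t \<omega>) \<in> measurable M (count_space UNIV)" for t
    by (rule measurable_compose_countable) simp
  moreover have "reindexed d lf lR t \<omega> \<in> {0, 1}" if "\<omega> \<in> space M" for t \<omega>
    using bin(2)[OF that] by (cases d) auto
  ultimately show ?thesis
    unfolding binary_process_iff using bin(1) binary_or_nat(1) by blast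
qed

lemma (in prob_space) Lambda_class_or_reindexed:
  assumes "lf \<in> Lambda_class M a" "lR \<in> Lambda_class M b"
  shows "(\<lambda>t \<omega>. lf t \<omega> OR reindexed d lf lR t \<omega>) \<in> Lambda_class M (a + b)"
proof -
  define E where "E = (\<lambda>l c k. {\<omega> \<in> space M. real (\<Sum>t = 0..<k. l t \<omega>) > c * real k})"
  define l where "l = (\<lambda>t \<omega>. lf t \<omega> OR reindexed d lf lR t \<omega>)"
  have proc: "binary_process M lf" "binary_process M lR"
    and summ: "(\<lambda>k. prob (E lf a k)) summable_on {1..}" "(\<lambda>k. prob (E lR b k)) summable_on {1..}"
    using assms by (auto simp: Lambda_class_def E_def)
  have bin: "lf t \<omega> \<in> {0, 1}" "lR t \<omega> \<in> {0, 1}" if "\<omega> \<in> space M" for t \<omega>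
    using proc that unfolding binary_process_iff by auto
  \<comment> \<open>\<open>measure\<close> is 0 on sets outside \<open>events\<close>, so the
    monotonicity and subadditivity used below rely on this.\<close>
  have sets: "E l' c k \<in> events" if "binary_process M l'" for l' c k
  proof -
    have [measurable]: "\<And>t. l' t \<in> measurable M (count_space UNIV)"
      using that unfolding binary_process_iff by blast
    show ?thesis unfolding E_def by measurable
  qed
  \<comment> \<open>The threshold splits as \<open>a * k + b * k\<close>: if both counts stayed
    within their shares, so would their sum, which dominates the count for \<open>l\<close>.\<close>
  have sub: "E l (a + b) k \<subseteq> E lf a k \<union> E lR b k" for k
  proof
    fix \<omega> assume \<omega>: "\<omega> \<in> E l (a + b) k"
    then have "\<omega> \<in> space M" by (simp add: E_def)
    then have "(\<Sum>t = 0..<k. l t \<omega>) \<le> (\<Sum>t = 0..<k. lf t \<omega>) + (\<Sum>t = 0..<k. lR t \<omega>)"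
      unfolding l_def by (intro sum_or_reindexed_le bin)
    then have "real (\<Sum>t = 0..<k. l t \<omega>) \<le> real (\<Sum>t = 0..<k. lf t \<omega>) + real (\<Sum>t = 0..<k. lR t \<omega>)"
      by (metis of_nat_add of_nat_le_iff)
    then show "\<omega> \<in> E lf a k \<union> E lR b k"
      using \<omega> unfolding E_def by (auto simp: distrib_right simp del: of_nat_sum)
  qed
  \<comment> \<open>Subadditivity holds under any dependence between \<open>lf\<close> and
    \<open>lR\<close>.\<close>
  have "prob (E l (a + b) k) \<le> prob (E lf a k) + prob (E lR b k)" for k
    using finite_measure_mono[OF sub] measure_Un_le[of "E lf a k" M "E lR b k"] sets proc
    by (meson order_trans sets.Un)
  then have "(\<lambda>k. prob (E l (a + b) k)) summable_on {1..}"
    using summable_on_comparison_test[OF summable_on_add[OF summ]] by simp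
  then show ?thesis
    using binary_process_or_reindexed[OF proc] by (simp add: Lambda_class_def E_def l_def)
qed

text \<open>Passing to the remaining subpath shifts the link numbers by 1, so the induction must
  allow \<open>\<rho>\<close> to be replaced by \<open>\<lambda>j. \<rho> (j + 1)\<close>. The empty
  list, where \<open>path_failure\<close> is unspecified, is excluded by
  \<open>P \<noteq> []\<close>.\<close>

lemma (in prob_space) path_failure_in_Lambda_class:
  assumes "P \<noteq> []" "\<And>j. j \<in> {1..length P} \<Longrightarrow> l j \<in> Lambda_class M (\<rho> j)"
  shows "path_failure P l \<in> Lambda_class M (\<Sum>j = 1..length P. \<rho> j)"
  using assms
proof (induction P l arbitrary: \<rho> rule: path_failure.induct)
  case (1 e l)
  then show ?case by simp
next
  case (2 e e' R l)
  let ?n = "length (e' # R)"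
  have "path_failure (e' # R) (\<lambda>j. l (j + 1)) \<in> Lambda_class M (\<Sum>j = 1..?n. \<rho> (j + 1))"
    using "2.prems" by (intro "2.IH") auto
  moreover have "l 1 \<in> Lambda_class M (\<rho> 1)"
    using "2.prems" by simp
  ultimately have "path_failure (e # e' # R) l \<in> Lambda_class M (\<rho> 1 + (\<Sum>j = 1..?n. \<rho> (j + 1)))"
    unfolding path_failure.simps(2) by (intro Lambda_class_or_reindexed)
  moreover have "(\<Sum>j = 1..Suc n. \<rho> j) = \<rho> 1 + (\<Sum>j = 1..n. \<rho> (j + 1))" for n
    by (induction n) simp_all
  ultimately show ?case
    by (simp only: length_Cons)
qed simp

theorem theorem4p8:
  fixes M :: "'a measure"
    and P :: "'v link list"
    and l :: "nat \<Rightarrow> 'a process"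
    and \<rho> :: "nat \<Rightarrow> real"
  assumes "prob_space M"
    and "is_path P"
    and "\<And>j. j \<in> {1..length P} \<Longrightarrow> \<rho> j \<in> {0..1}"
    and "\<And>j. j \<in> {1..length P} \<Longrightarrow> l j \<in> Lambda_class M (\<rho> j)"
    and "(\<Sum>j = 1..length P. \<rho> j) \<le> 1"
  shows "path_failure P l \<in> Lambda_class M (\<Sum>j = 1..length P. \<rho> j)"
  using assms(2,4) unfolding is_path_def
  by (intro prob_space.path_failure_in_Lambda_class[OF assms(1)]) auto

end
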